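(* Let $\eta,\eta'$ be Borel probability measures on $\mathbb{R}$ with finite first moment. Then the following statements hold: (i) $U_\eta$ is well-defined on $[0,1]$ and convex, with $U_\eta(0)=0$ and $U_\eta(1)=\mathrm{mean}(\eta)$. (ii) $\eta$ is dominated in convex order by $\eta'$ if and only if $U_\eta(1)=U_{\eta'}(1)$ and $U_\eta(p)\ge U_{\eta'}(p)$ for all $p\in(0,1)$. (iii) The pair $(\eta,\eta')$ is irreducible if and only if $U_\eta(1)=U_{\eta'}(1)$ and $U_\eta(p)>U_{\eta'}(p)$ for all $p\in(0,1)$.
   Context: For a Borel probability measure $\xi$ on $\mathbb{R}$ with cumulative distribution function $F_\xi$, $Q_\xi(u)=\inf\{y\in\mathbb{R}:F_\xi(y)\ge u\}$, $u\in(0,1)$, is its left-continuous quantile function, and $\mathrm{mean}(\xi)=\int y\,\xi(dy)$. The integrated quantile function of $\eta$ is $U_\eta:[0,1]\to\mathbb{R}$, $U_\eta(p)=\int_0^pQ_\eta(u)\,du$. Convex order: $\eta\preceq_c\eta'$ ($\eta$ is dominated by $\eta'$ in convex order) means $\int\varphi\,d\eta\le\int\varphi\,d\eta'$ for every convex $\varphi:\mathbb{R}\to\mathbb{R}$ for which both integrals are well-defined. For $\rho$ with finite first moment let $C_\rho(x)=\int_{\mathbb{R}}(y-x)^+\rho(dy)$. The pair $(\eta,\eta')$ is irreducible if $\eta\preceq_c\eta'$ and the set $I=\{x\in\mathbb{R}:C_\eta(x)<C_{\eta'}(x)\}$ is an interval with $\eta(I)=1$. *)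

theory Defs
  imports "HOL-Probability.Probability"
begin

definition quantile :: "real measure \<Rightarrow> real \<Rightarrow> real" where
  "quantile M u = Inf {y. u \<le> cdf M y}"

(* The open interval of integration keeps Q within its domain (0,1), also for p = 1. *)
definition integrated_quantile :: "real measure \<Rightarrow> real \<Rightarrow> real" where
  "integrated_quantile M p = (LINT u:{0<..<p}|lborel. quantile M u)"

(* Inf on the reals and the Bochner integral are total functions.  This says that Q is
   genuinely an infimum on (0,1) and that the integrals defining U on [0,1] exist. *)
definition integrated_quantile_well_defined :: "real measure \<Rightarrow> bool" where
  "integrated_quantile_well_defined M \<longleftrightarrow>
     (\<forall>u\<in>{0<..<1}. {y. u \<le> cdf M y} \<noteq> {} \<and> bdd_below {y. u \<le> cdf M y}) \<and>
     (\<forall>p\<in>{0..1}. set_integrable lborel {0<..<p} (quantile M))"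

definition mean :: "real measure \<Rightarrow> real" where
  "mean M = (LINT y|M. y)"

(* The integral is well-defined, possibly infinite, when the positive and the negative part
   do not both have infinite integral.  Note that ennreal truncates negative reals to 0. *)
definition integral_well_defined :: "real measure \<Rightarrow> (real \<Rightarrow> real) \<Rightarrow> bool" where
  "integral_well_defined M f \<longleftrightarrow> f \<in> borel_measurable M \<and>
     ((\<integral>\<^sup>+x. ennreal (f x) \<partial>M) < \<infinity> \<or> (\<integral>\<^sup>+x. ennreal (- f x) \<partial>M) < \<infinity>)"

definition extended_integral :: "real measure \<Rightarrow> (real \<Rightarrow> real) \<Rightarrow> ereal" where
  "extended_integral M f =
     enn2ereal (\<integral>\<^sup>+x. ennreal (f x) \<partial>M) - enn2ereal (\<integral>\<^sup>+x. ennreal (- f x) \<partial>M)"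

definition convex_order :: "real measure \<Rightarrow> real measure \<Rightarrow> bool"  (infix \<open>\<preceq>\<^sub>c\<close> 50) where
  "M \<preceq>\<^sub>c N \<longleftrightarrow>
     (\<forall>\<phi>. convex_on UNIV \<phi> \<and> integral_well_defined M \<phi> \<and> integral_well_defined N \<phi> \<longrightarrow>
          extended_integral M \<phi> \<le> extended_integral N \<phi>)"

definition call_function :: "real measure \<Rightarrow> real \<Rightarrow> real" where
  "call_function M x = (LINT y|M. max (y - x) 0)"

definition irreducible_pair :: "real measure \<Rightarrow> real measure \<Rightarrow> bool" where
  "irreducible_pair M N \<longleftrightarrow> M \<preceq>\<^sub>c N \<and>
     (let I = {x. call_function M x < call_function N x} in is_interval I \<and> measure M I = 1)"

end

theory Submission
  imports Defs
begin

text \<open>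
  Write \<open>P\<close> for the put function \<open>x \<mapsto> E (x - Y)\<^sup>+\<close> of a law with finite mean, \<open>Q\<close> for its
  quantile function and \<open>U\<close> for its integrated quantile function. Under the uniform measure on
  \<open>(0,1)\<close> the function \<open>Q\<close> has the given law, so \<open>P x\<close> is the integral of \<open>(x - Q u)\<^sup>+\<close>. Comparing
  this integrand with \<open>x - Q u\<close> on \<open>(0,p)\<close> gives \<open>p x - U p \<le> P x\<close>, with equality exactly when
  \<open>Q \<le> x\<close> almost everywhere below \<open>p\<close> and \<open>Q \<ge> x\<close> almost everywhere above \<open>p\<close>. This says that \<open>U\<close>
  and \<open>P\<close> are convex conjugates (\<open>put_ge\<close>, \<open>put_eq_iff\<close>); equality holds at \<open>x = Q p\<close> and at
  \<open>p = F x\<close>. Hence \<open>Q p\<close> is a subgradient of \<open>U\<close> at \<open>p\<close>, and \<open>U\<close> is convex.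

  Convex order gives equal means and ordered call functions, hence, by put-call parity, ordered put
  functions, and conjugation reverses their order. Conversely, let the functions \<open>U\<close> be ordered,
  with equal values at 1. For convex \<open>\<phi>\<close> with subgradient \<open>g\<close>, integrate
  \<open>\<phi> (Q' u) - \<phi> (Q u) \<ge> g (Q u) (Q' u - Q u)\<close>: the difference \<open>Q' - Q\<close> has total integral 0 and
  nonpositive integral over every \<open>(0,p)\<close>, so weighting it by the increasing function \<open>g \<circ> Q\<close> gives
  a nonnegative integral (\<open>integral_monotone_weight_nonneg\<close>). That argument needs a bounded weight;
  so \<open>\<phi>\<close> is first replaced by its affine extension outside \<open>[-r,r]\<close>, and monotone convergence as
  \<open>r\<close> tends to infinity reaches the possibly infinite integral of \<open>\<phi>\<close>.

  For irreducibility, let \<open>I\<close> be the set where the call, equivalently the put, functions differ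
  strictly. Suppose the pair is irreducible and \<open>U p = U' p\<close> for some \<open>0 < p < 1\<close>. At \<open>x = Q' p\<close>
  equality then holds in both conjugacy inequalities, so \<open>x \<notin> I\<close>, while
  \<open>Q \<le> x\<close> and \<open>Q \<ge> x\<close> both hold on sets of positive measure. This is impossible because \<open>Q\<close> has values in the interval \<open>I\<close> almost
  everywhere. Conversely, strictly ordered \<open>U\<close> and \<open>U'\<close> put every point where the first conjugacy
  inequality is an equality for some interior \<open>p\<close> into \<open>I\<close>. In particular \<open>I\<close> contains all values
  of \<open>Q\<close>, and what remains is to see that \<open>I\<close> is the interval where the put and the call function
  of the second law are both positive.
\<close>

section \<open>The uniform measure on the unit interval\<close>

abbreviation unif :: "real measure" where
  "unif \<equiv> restrict_space lborel {0<..<1}"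

lemma prob_space_unif: "prob_space unif"
  by (auto simp add: emeasure_restrict_space space_restrict_space intro!: prob_spaceI)

interpretation unif: prob_space unif
  by (rule prob_space_unif)

lemma AE_unif: "(AE u in unif. R u) \<longleftrightarrow> (AE u in lborel. 0 < u \<and> u < 1 \<longrightarrow> R u)"
  by (subst AE_restrict_space_iff) auto

lemma AE_unif_neq: "AE u in unif. u \<noteq> a"
  unfolding AE_unif using AE_lborel_singleton[of a] by eventually_elim auto

lemma not_AE_unif_interval:
  assumes "a < b" "0 \<le> a" "b \<le> 1" and "AE u in unif. u \<notin> {a<..<b}"
  shows False
proof -
  have "AE u in lborel. u \<notin> {a<..<b}"
    using assms(4) unfolding AE_unif by eventually_elim (use assms in auto)
  then have "emeasure lborel {a<..<b} = 0"
    using AE_iff_measurable[of "{a<..<b}" lborel "\<lambda>u. u \<notin> {a<..<b}"]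
    by (auto simp: greaterThanLessThan_def greaterThan_def lessThan_def Int_def)
  with \<open>a < b\<close> show False by simp
qed

lemma measurable_unif:
  "f \<in> borel_measurable borel \<Longrightarrow> f \<in> borel_measurable unif"
  by (auto intro: measurable_restrict_space1)

lemma measurable_unif_mono_on:
  assumes "mono_on {0<..<1} (h :: real \<Rightarrow> real)"
  shows "h \<in> borel_measurable unif"
proof -
  have "h \<in> borel_measurable (restrict_space borel {0<..<1})"
    by (rule borel_measurable_mono_on_fnc[OF assms])
  also have "borel_measurable (restrict_space borel {0<..<1}) = borel_measurable unif"
    by (intro measurable_cong_sets) (auto simp: sets_restrict_space)
  finally show ?thesis .
qed

lemma measurable_unif_indicator [measurable]:
  "(indicator {..<p} :: real \<Rightarrow> real) \<in> borel_measurable unif"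
  by (intro measurable_unif) simp

lemma integrable_unif_initial:
  fixes f :: "real \<Rightarrow> real"
  assumes [measurable]: "integrable unif f"
  shows "integrable unif (\<lambda>u. indicator {..<p} u * f u)"
  by (rule Bochner_Integration.integrable_bound[OF assms]) (auto split: split_indicator)

lemma integral_unif_initial:
  fixes f :: "real \<Rightarrow> real"
  assumes "p \<le> 1"
  shows "(LINT u|unif. indicator {..<p} u * f u) = (LINT u:{0<..<p}|lborel. f u)"
  unfolding set_lebesgue_integral_def
  by (subst integral_restrict_space)
     (use assms in \<open>auto intro!: Bochner_Integration.integral_cong split: split_indicator\<close>)

lemma integral_unif_indicator:
  assumes "0 \<le> p" "p \<le> 1"
  shows "(LINT u|unif. indicator {..<p} u) = (p::real)"
proof -
  have "(LINT u|unif. indicator {..<p} u * 1) = (p::real)"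
    by (subst integral_unif_initial) (use assms in \<open>auto simp: set_lebesgue_integral_def\<close>)
  then show ?thesis by simp
qed

section \<open>Quantile functions and the conjugacy with put functions\<close>

definition put_function :: "real measure \<Rightarrow> real \<Rightarrow> real" where
  "put_function M x = (LINT y|M. max (x - y) 0)"

locale finite_mean_distribution = cdf_distribution M for M +
  assumes integrable_ident: "integrable M (\<lambda>y. y)"
begin

lemma quantile_le_iff:
  assumes "0 < u" "u < 1"
  shows "quantile M u \<le> x \<longleftrightarrow> u \<le> cdf M x"
  unfolding quantile_def by (rule pseudoinverse[OF assms, symmetric])

lemma quantile_mono: "\<lbrakk>0 < u; u \<le> v; v < 1\<rbrakk> \<Longrightarrow> quantile M u \<le> quantile M v"
  using quantile_le_iff[of u "quantile M v"] quantile_le_iff[of v "quantile M v"] by linarith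

lemma quantile_eq_pseudoinverse: "quantile M = I"
  by (rule ext) (rule quantile_def)

lemma quantile_measurable [measurable]: "quantile M \<in> borel_measurable unif"
  by (intro measurable_unif_mono_on mono_onI quantile_mono) auto

lemma distr_quantile: "distr unif borel (quantile M) = M"
  unfolding quantile_eq_pseudoinverse by (rule distr_I_eq_M)

lemma integral_quantile:
  fixes f :: "real \<Rightarrow> real"
  assumes "f \<in> borel_measurable borel"
  shows "(LINT u|unif. f (quantile M u)) = (LINT y|M. f y)"
  using integral_distr[OF quantile_measurable assms] unfolding distr_quantile by (rule sym)

lemma integrable_quantile_iff:
  fixes f :: "real \<Rightarrow> real"
  assumes "f \<in> borel_measurable borel"
  shows "integrable unif (\<lambda>u. f (quantile M u)) \<longleftrightarrow> integrable M f"
  using integrable_distr_eq[OF quantile_measurable assms] unfolding distr_quantile by (rule sym)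

lemma integrable_quantile: "integrable unif (quantile M)"
  by (rule integrable_quantile_iff[THEN iffD2, OF _ integrable_ident]) simp

lemma AE_quantile:
  assumes "Measurable.pred borel R"
  shows "(AE y in M. R y) \<longleftrightarrow> (AE u in unif. R (quantile M u))"
  using AE_distr_iff[OF quantile_measurable, of R] assms unfolding distr_quantile by simp

lemma integrated_quantile_unif:
  "p \<le> 1 \<Longrightarrow> integrated_quantile M p = (LINT u|unif. indicator {..<p} u * quantile M u)"
  by (simp add: integrated_quantile_def integral_unif_initial)

lemma integrated_quantile_0: "integrated_quantile M 0 = 0"
  by (simp add: integrated_quantile_def set_lebesgue_integral_def)

lemma integrated_quantile_1: "integrated_quantile M 1 = mean M"
proof -
  have "integrated_quantile M 1 = (LINT u|unif. quantile M u)"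
    unfolding integrated_quantile_unif[OF order_refl]
    by (intro Bochner_Integration.integral_cong) (auto simp: space_restrict_space)
  then show ?thesis
    using integral_quantile[of "\<lambda>y. y"] by (simp add: mean_def)
qed

lemma integrated_quantile_well_defined: "integrated_quantile_well_defined M"
  unfolding integrated_quantile_well_defined_def
proof (intro conjI ballI)
  fix u :: real assume u: "u \<in> {0<..<1}"
  show "{y. u \<le> cdf M y} \<noteq> {}"
    using quantile_le_iff[of u "quantile M u"] u by auto
  show "bdd_below {y. u \<le> cdf M y}"
    using quantile_le_iff[of u] u by (intro bdd_belowI[of _ "quantile M u"]) auto
next
  fix p :: real assume p: "p \<in> {0..1}"
  have "integrable lborel (\<lambda>u. indicator {0<..<1} u *\<^sub>R (indicator {..<p} u * quantile M u))"
    using integrable_unif_initial[OF integrable_quantile, of p]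
    by (subst (asm) integrable_restrict_space) auto
  also have "(\<lambda>u. indicator {0<..<1} u *\<^sub>R (indicator {..<p} u * quantile M u))
      = (\<lambda>u. indicator {0<..<p} u *\<^sub>R quantile M u)"
    using p by (auto simp: fun_eq_iff split: split_indicator)
  finally show "set_integrable lborel {0<..<p} (quantile M)"
    by (simp add: set_integrable_def)
qed

lemma integrable_put: "integrable M (\<lambda>y. max (x - y) 0)"
  using integrable_ident by auto

lemma integrable_call: "integrable M (\<lambda>y. max (y - x) 0)"
  using integrable_ident by auto

text \<open>
  The reason is \<open>(y - x)\<^sup>+ - (x - y)\<^sup>+ = y - x\<close>. For laws with equal means, comparing call functions
  is therefore the same as comparing put functions, and the latter are conjugate to \<open>U\<close>.
\<close>

lemma put_call_parity: "call_function M x = put_function M x + mean M - x"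
proof -
  have "call_function M x - put_function M x = (LINT y|M. max (y - x) 0 - max (x - y) 0)"
    unfolding call_function_def put_function_def
    by (rule Bochner_Integration.integral_diff[symmetric, OF integrable_call integrable_put])
  also have "\<dots> = (LINT y|M. y - x)"
    by (intro Bochner_Integration.integral_cong) auto
  also have "\<dots> = mean M - x"
    using integrable_ident prob_space by (simp add: mean_def)
  finally show ?thesis by simp
qed

lemma put_mono: "x \<le> y \<Longrightarrow> put_function M x \<le> put_function M y"
  unfolding put_function_def by (intro integral_mono integrable_put) auto

lemma call_antimono: "x \<le> y \<Longrightarrow> call_function M y \<le> call_function M x"
  unfolding call_function_def by (intro integral_mono integrable_call) auto

lemma put_nonneg: "0 \<le> put_function M x"
  unfolding put_function_def by (intro Bochner_Integration.integral_nonneg) auto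

lemma call_nonneg: "0 \<le> call_function M x"
  unfolding call_function_def by (intro Bochner_Integration.integral_nonneg) auto

text \<open>
  The gap in the conjugacy inequality is the integral of a nonnegative function, which is 0 at a
  point below \<open>p\<close> iff \<open>Q \<le> x\<close> there, and at a point above \<open>p\<close> iff \<open>x \<le> Q\<close> there.
\<close>

lemma put_gap:
  fixes x p :: real
  defines "gap \<equiv> \<lambda>u. max (x - quantile M u) 0 - indicator {..<p} u * (x - quantile M u)"
  assumes "0 \<le> p" "p \<le> 1"
  shows "integrable unif gap"
    and "(LINT u|unif. gap u) = put_function M x - (p * x - integrated_quantile M p)"
proof -
  note [simp] = integrable_quantile
  have max: "integrable unif (\<lambda>u. max (x - quantile M u) 0)"
    by auto
  have ini: "integrable unif (\<lambda>u. indicator {..<p} u * (x - quantile M u))"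
    by (intro integrable_unif_initial) auto
  show "integrable unif gap"
    unfolding gap_def using max ini by auto
  have "(LINT u|unif. gap u) = (LINT u|unif. max (x - quantile M u) 0)
      - (LINT u|unif. indicator {..<p} u * (x - quantile M u))"
    unfolding gap_def using max ini by (rule Bochner_Integration.integral_diff)
  also have "(LINT u|unif. max (x - quantile M u) 0) = put_function M x"
    unfolding put_function_def by (rule integral_quantile) simp
  also have "(LINT u|unif. indicator {..<p} u * (x - quantile M u))
      = (LINT u|unif. indicator {..<p} u * x - indicator {..<p} u * quantile M u)"
    by (simp add: right_diff_distrib)
  also have "\<dots> = (LINT u|unif. indicator {..<p} u * x) - (LINT u|unif. indicator {..<p} u * quantile M u)"
    by (intro Bochner_Integration.integral_diff integrable_unif_initial) auto
  also have "\<dots> = p * x - integrated_quantile M p"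
    using assms integral_unif_indicator[of p] by (simp add: integrated_quantile_unif)
  finally show "(LINT u|unif. gap u) = put_function M x - (p * x - integrated_quantile M p)" .
qed

lemma put_ge:
  assumes "0 \<le> p" "p \<le> 1"
  shows "p * x - integrated_quantile M p \<le> put_function M x"
proof -
  have "0 \<le> (LINT u|unif. max (x - quantile M u) 0 - indicator {..<p} u * (x - quantile M u))"
    by (intro Bochner_Integration.integral_nonneg) (auto split: split_indicator)
  then show ?thesis
    unfolding put_gap(2)[OF assms] by simp
qed

lemma put_eq_iff:
  assumes "0 \<le> p" "p \<le> 1"
  shows "put_function M x = p * x - integrated_quantile M p \<longleftrightarrow>
    (AE u in unif. (u < p \<longrightarrow> quantile M u \<le> x) \<and> (p \<le> u \<longrightarrow> x \<le> quantile M u))"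
proof -
  let ?gap = "\<lambda>u. max (x - quantile M u) 0 - indicator {..<p} u * (x - quantile M u)"
  have "put_function M x = p * x - integrated_quantile M p \<longleftrightarrow> (LINT u|unif. ?gap u) = 0"
    unfolding put_gap(2)[OF assms] by simp
  also have "\<dots> \<longleftrightarrow> (AE u in unif. ?gap u = 0)"
    by (intro integral_nonneg_eq_0_iff_AE put_gap(1)[OF assms]) (auto split: split_indicator)
  also have "\<dots> \<longleftrightarrow>
      (AE u in unif. (u < p \<longrightarrow> quantile M u \<le> x) \<and> (p \<le> u \<longrightarrow> x \<le> quantile M u))"
    by (intro AE_cong) (auto split: split_indicator)
  finally show ?thesis .
qed

text \<open>
  Attainment of the supremum \<open>U p = sup\<^sub>x (p x - P x)\<close>: monotonicity of \<open>Q\<close> puts its values on the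
  right side of \<open>Q p\<close>.
\<close>

lemma put_quantile:
  assumes "0 < p" "p < 1"
  shows "put_function M (quantile M p) = p * quantile M p - integrated_quantile M p"
  using assms by (subst put_eq_iff) (auto simp: space_restrict_space intro!: AE_I2 quantile_mono)

text \<open>
  Attainment of the dual supremum \<open>P x = sup\<^sub>p (p x - U p)\<close>. The values \<open>F x = 0\<close> and \<open>F x = 1\<close> are
  included; they say that \<open>P x = 0\<close> and that \<open>P x = x - mean\<close>, that is, a vanishing call function.
\<close>

lemma put_cdf: "put_function M x = cdf M x * x - integrated_quantile M (cdf M x)"
proof (subst put_eq_iff)
  show "AE u in unif. (u < cdf M x \<longrightarrow> quantile M u \<le> x) \<and> (cdf M x \<le> u \<longrightarrow> x \<le> quantile M u)"
    using AE_unif_neq[of "cdf M x"] AE_space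
  proof eventually_elim
    case (elim u)
    then show ?case
      using quantile_le_iff[of u x] by (auto simp: space_restrict_space)
  qed
qed (auto simp: cdf_nonneg cdf_bounded_prob)

text \<open>
  Both \<open>U q\<close> and \<open>U z\<close> are compared with \<open>P x\<close> at \<open>x = Q z\<close>, where \<open>z\<close> gives equality.
\<close>

lemma integrated_quantile_supporting_line:
  assumes "0 < z" "z < 1" "0 \<le> q" "q \<le> 1"
  shows "integrated_quantile M z + quantile M z * (q - z) \<le> integrated_quantile M q"
  using put_ge[of q "quantile M z"] put_quantile[of z] assms by (simp add: algebra_simps)

lemma convex_integrated_quantile: "convex_on {0..1} (integrated_quantile M)"
proof (rule convex_onI)
  fix t x y :: real
  let ?U = "integrated_quantile M"
  assume t: "0 < t" "t < 1" and xy: "x \<in> {0..1}" "y \<in> {0..1}"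
  define z where "z = (1 - t) * x + t * y"
  have "?U z \<le> (1 - t) * ?U x + t * ?U y"
  proof (cases "x = y")
    case True
    then show ?thesis by (simp add: z_def algebra_simps)
  next
    case False
    \<comment> \<open>The supporting line exists only at interior points, even if \<open>x\<close> or \<open>y\<close> is an endpoint.\<close>
    have z: "0 < z" "z < 1"
    proof -
      have pos: "0 < (1 - t) * a + t * b" if "0 \<le> a" "0 \<le> b" "a \<noteq> b" for a b
      proof (cases "a = 0")
        case True
        then show ?thesis using t that by simp
      next
        case False
        then show ?thesis using t that by (intro add_pos_nonneg) simp_all
      qed
      show "0 < z" using pos[of x y] False xy by (simp add: z_def)
      have "1 - z = (1 - t) * (1 - x) + t * (1 - y)"
        by (simp add: z_def algebra_simps)
      then show "z < 1" using pos[of "1 - x" "1 - y"] False xy by simp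
    qed
    have "(1 - t) * (?U z + quantile M z * (x - z)) + t * (?U z + quantile M z * (y - z))
        \<le> (1 - t) * ?U x + t * ?U y"
      using t xy z by (intro add_mono mult_left_mono integrated_quantile_supporting_line) auto
    moreover have "(1 - t) * (?U z + quantile M z * (x - z)) + t * (?U z + quantile M z * (y - z)) = ?U z"
      by (simp add: z_def algebra_simps)
    ultimately show ?thesis by simp
  qed
  then show "?U ((1 - t) *\<^sub>R x + t *\<^sub>R y) \<le> (1 - t) * ?U x + t * ?U y"
    by (simp add: z_def)
qed auto

end

section \<open>Monotone weights\<close>

text \<open>
  Since \<open>h\<close> is increasing, its upper level set agrees up to one point with an interval \<open>(p,1)\<close>, and
  the integral of \<open>D\<close> over \<open>(p,1)\<close> is minus the one over \<open>(0,p)\<close>.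
\<close>

lemma integral_upper_level_nonneg:
  fixes h D :: "real \<Rightarrow> real"
  assumes mono: "mono_on {0<..<1} h"
    and D: "integrable unif D" "(LINT u|unif. D u) = 0"
    and initial: "\<And>p. \<lbrakk>0 < p; p < 1\<rbrakk> \<Longrightarrow> (LINT u|unif. indicator {..<p} u * D u) \<le> 0"
  shows "0 \<le> (LINT u|unif. indicator {u. t < h u} u * D u)"
proof -
  define S where "S = {u \<in> {0<..<1}. t < h u}"
  have meas: "(\<lambda>u. indicator {u. t < h u} u * D u) \<in> borel_measurable unif"
  proof -
    have [measurable]: "h \<in> borel_measurable unif" by (rule measurable_unif_mono_on[OF mono])
    have [measurable]: "D \<in> borel_measurable unif" using D(1) by auto
    have "(\<lambda>u. if t < h u then D u else 0) \<in> borel_measurable unif" by measurable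
    then show ?thesis by (rule measurable_cong[THEN iffD1, rotated]) (auto simp: indicator_def)
  qed
  show ?thesis
  proof (cases "S = {}")
    case True
    then have "(LINT u|unif. indicator {u. t < h u} u * D u) = (LINT u|unif. 0)"
      by (intro Bochner_Integration.integral_cong)
         (auto simp: S_def space_restrict_space indicator_def)
    then show ?thesis by simp
  next
    case False
    define p where "p = Inf S"
    have bdd: "bdd_below S" by (auto simp: S_def intro!: bdd_belowI[of _ 0])
    have p: "0 \<le> p" "p < 1"
    proof -
      show "0 \<le> p" unfolding p_def using False by (intro cInf_greatest) (auto simp: S_def)
      obtain s where "s \<in> S" using False by auto
      then have "p \<le> s" "s < 1" unfolding p_def using bdd by (auto intro: cInf_lower simp: S_def)
      then show "p < 1" by simp
    qed
    have up: "t < h u" if "p < u" "u < 1" for u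
    proof -
      from that(1) obtain s where s: "s \<in> S" "s < u"
        unfolding p_def by (auto simp: cInf_less_iff[OF False bdd])
      then have "h s \<le> h u"
        using that(2) by (intro mono_onD[OF mono]) (auto simp: S_def)
      with s show ?thesis by (auto simp: S_def)
    qed
    have down: "\<not> t < h u" if "0 < u" "u < p" for u
      using cInf_lower[OF _ bdd, of u] that p unfolding p_def[symmetric] by (auto simp: S_def)
    have "(LINT u|unif. indicator {u. t < h u} u * D u)
        = (LINT u|unif. D u - indicator {..<p} u * D u)"
    proof (rule integral_cong_AE)
      show "AE u in unif. indicator {u. t < h u} u * D u = D u - indicator {..<p} u * D u"
        using AE_unif_neq[of p] AE_space
      proof eventually_elim
        case (elim u)
        then show ?case
          using up[of u] down[of u] by (cases "u < p") (auto simp: space_restrict_space indicator_def)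
      qed
    qed (use meas D integrable_unif_initial in auto)
    also have "\<dots> = - (LINT u|unif. indicator {..<p} u * D u)"
      using D integrable_unif_initial[OF D(1)] by simp
    also have "\<dots> \<ge> 0"
    proof (cases "p = 0")
      case True
      have "(LINT u|unif. indicator {..<p} u * D u) = (LINT u|unif. 0)"
        by (intro Bochner_Integration.integral_cong) (auto simp: True space_restrict_space)
      then show ?thesis by simp
    next
      case False
      then show ?thesis using initial[of p] p by simp
    qed
    finally show ?thesis .
  qed
qed

text \<open>
  Layer-cake argument: \<open>h - a\<close> is the integral over \<open>t \<ge> 0\<close> of the indicators of
  \<open>{u. t + a < h u}\<close>. Subtracting the constant \<open>a\<close> does not change the weighted integral because
  \<open>D\<close> has integral 0, and Fubini reduces the claim to the upper level sets.
\<close>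

lemma integral_monotone_weight_nonneg:
  fixes h D :: "real \<Rightarrow> real"
  assumes mono: "mono_on {0<..<1} h" and bounds: "\<And>u. \<lbrakk>0 < u; u < 1\<rbrakk> \<Longrightarrow> a \<le> h u \<and> h u \<le> b"
    and D: "integrable unif D" "(LINT u|unif. D u) = 0"
    and initial: "\<And>p. \<lbrakk>0 < p; p < 1\<rbrakk> \<Longrightarrow> (LINT u|unif. indicator {..<p} u * D u) \<le> 0"
  shows "integrable unif (\<lambda>u. h u * D u)" and "0 \<le> (LINT u|unif. h u * D u)"
proof -
  interpret pair_sigma_finite unif lborel
    by (intro pair_sigma_finite.intro) (rule unif.sigma_finite_measure_axioms lborel.sigma_finite_measure_axioms)+
  have [measurable]: "D \<in> borel_measurable unif" using D(1) by auto
  have [measurable]: "h \<in> borel_measurable unif" by (rule measurable_unif_mono_on[OF mono])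
  have bnd: "integrable unif (\<lambda>u. k u * D u)"
    if [measurable]: "k \<in> borel_measurable unif" and "\<And>u. \<lbrakk>0 < u; u < 1\<rbrakk> \<Longrightarrow> \<bar>k u\<bar> \<le> c" for k c
  proof (rule Bochner_Integration.integrable_bound)
    show "integrable unif (\<lambda>u. c * D u)" using D by simp
    show "AE u in unif. norm (k u * D u) \<le> norm (c * D u)"
      using that(2) by (intro AE_I2) (fastforce simp: space_restrict_space abs_mult intro!: mult_right_mono)
  qed measurable
  show int: "integrable unif (\<lambda>u. h u * D u)"
    using bounds by (intro bnd[of h "\<bar>a\<bar> + \<bar>b\<bar>"]) force+
  define f where "f u t = (if 0 \<le> t \<and> t < h u - a then D u else 0)" for u t
  have f_norm: "(LINT t|lborel. norm (f u t)) = (h u - a) * \<bar>D u\<bar>"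
    and f_int: "integrable lborel (f u)"
    and f_eq: "(LINT t|lborel. f u t) = (h u - a) * D u" if "0 < u" "u < 1" for u
  proof -
    have *: "f u = (\<lambda>t. indicator {0..<h u - a} t * D u)"
      "(\<lambda>t. norm (f u t)) = (\<lambda>t. indicator {0..<h u - a} t * \<bar>D u\<bar>)"
      by (auto simp: f_def fun_eq_iff indicator_def)
    show "(LINT t|lborel. norm (f u t)) = (h u - a) * \<bar>D u\<bar>"
      unfolding *(2) using bounds[OF that] by simp
    show "(LINT t|lborel. f u t) = (h u - a) * D u"
      unfolding *(1) using bounds[OF that] by simp
    show "integrable lborel (f u)"
      unfolding *(1) using bounds[OF that]
      by (intro integrable_mult_left integrable_real_indicator) auto
  qed
  have f_integrable: "integrable (unif \<Otimes>\<^sub>M lborel) (case_prod f)"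
  proof (rule Fubini_integrable)
    show "case_prod f \<in> borel_measurable (unif \<Otimes>\<^sub>M lborel)"
      unfolding f_def by measurable
    have "integrable unif (\<lambda>u. \<bar>(h u - a) * D u\<bar>)"
      using bounds by (intro integrable_abs bnd[of _ "b - a"]) force+
    then show "integrable unif (\<lambda>u. LINT t|lborel. norm (case_prod f (u, t)))"
      by (rule Bochner_Integration.integrable_cong[THEN iffD1, rotated 2])
         (use bounds in \<open>auto simp: f_norm[simplified] space_restrict_space abs_mult\<close>)
    show "AE u in unif. integrable lborel (\<lambda>t. case_prod f (u, t))"
      by (intro AE_I2) (auto simp: f_int space_restrict_space)
  qed
  have "(LINT u|unif. h u * D u) = (LINT u|unif. (h u - a) * D u)"
    using int D by (simp add: left_diff_distrib)
  also have "\<dots> = (LINT u|unif. LINT t|lborel. f u t)"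
    by (intro Bochner_Integration.integral_cong) (auto simp: f_eq space_restrict_space)
  also have "\<dots> = (LINT t|lborel. LINT u|unif. f u t)"
    by (rule Fubini_integral[OF f_integrable, symmetric])
  also have "\<dots> \<ge> 0"
  proof (rule Bochner_Integration.integral_nonneg)
    fix t :: real
    show "0 \<le> (LINT u|unif. f u t)"
    proof (cases "0 \<le> t")
      case True
      then have "(LINT u|unif. f u t) = (LINT u|unif. indicator {u. t + a < h u} u * D u)"
        by (intro Bochner_Integration.integral_cong) (auto simp: f_def indicator_def)
      also have "\<dots> \<ge> 0"
        by (rule integral_upper_level_nonneg[OF mono D initial])
      finally show ?thesis .
    next
      case False
      then show ?thesis by (simp add: f_def)
    qed
  qed
  finally show "0 \<le> (LINT u|unif. h u * D u)" .
qed

section \<open>Convex functions with a monotone subgradient\<close>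

text \<open>
  The right derivative serves as \<open>g\<close>. Its monotonicity follows by adding the subgradient
  inequalities at \<open>x\<close> and \<open>y\<close>.
\<close>

lemma convex_on_UNIV_subgradient:
  fixes \<phi> :: "real \<Rightarrow> real"
  assumes "convex_on UNIV \<phi>"
  obtains g where "mono g" and "\<And>x y. \<phi> x + g x * (y - x) \<le> \<phi> y"
proof
  let ?g = "\<lambda>x. Inf ((\<lambda>t. (\<phi> x - \<phi> t) / (x - t)) ` ({x<..} \<inter> UNIV))"
  show sub: "\<phi> x + ?g x * (y - x) \<le> \<phi> y" for x y
    using convex_le_Inf_differential[OF assms, of x y] by simp
  show "mono ?g"
  proof (rule monoI)
    fix x y :: real assume "x \<le> y"
    show "?g x \<le> ?g y"
    proof (cases "x = y")
      case False
      have "0 \<le> (?g y - ?g x) * (y - x)"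
        using sub[of x y] sub[of y x] by (simp add: algebra_simps)
      with \<open>x \<le> y\<close> False show ?thesis by (simp add: zero_le_mult_iff)
    qed simp
  qed
qed

text \<open>
  The function \<open>\<phi>\<close> on \<open>[-r,r]\<close>, continued by its supporting lines at \<open>-r\<close> and \<open>r\<close>. Its slopes are
  bounded, so it is integrable for every law with finite mean.
\<close>

definition tangent_extension :: "(real \<Rightarrow> real) \<Rightarrow> (real \<Rightarrow> real) \<Rightarrow> real \<Rightarrow> real \<Rightarrow> real" where
  "tangent_extension \<phi> g r x =
     (let c = max (- r) (min r x) in \<phi> c + g c * (x - c))"

locale convex_with_subgradient =
  fixes \<phi> g :: "real \<Rightarrow> real"
  assumes convex: "convex_on UNIV \<phi>"
    and mono_g: "mono g"
    and subgradient: "\<And>x y. \<phi> x + g x * (y - x) \<le> \<phi> y"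
begin

text \<open>
  The extension is the maximum of the supporting lines of \<open>\<phi>\<close> at points of \<open>[-r,r]\<close>: going outwards
  from the endpoint \<open>c\<close> nearest to \<open>y\<close>, the line at \<open>c\<close> is the steepest one. The subgradient
  property and the monotonicity in \<open>r\<close> are consequences.
\<close>

lemma tangent_le_extension:
  assumes "\<bar>q\<bar> \<le> r"
  shows "\<phi> q + g q * (y - q) \<le> tangent_extension \<phi> g r y"
proof -
  define c where "c = max (- r) (min r y)"
  have "0 \<le> (g c - g q) * (y - c)"
  proof (cases y c rule: linorder_cases)
    case less
    then have "c \<le> q" using assms by (auto simp: c_def)
    then show ?thesis using less monoD[OF mono_g, of c q] by (intro mult_nonpos_nonpos) auto
  next
    case greater
    then have "q \<le> c" using assms by (auto simp: c_def)
    then show ?thesis using greater monoD[OF mono_g, of q c] by (intro mult_nonneg_nonneg) auto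
  qed simp
  then have "\<phi> q + g q * (y - q) \<le> \<phi> q + g q * (c - q) + g c * (y - c)"
    by (simp add: algebra_simps)
  also have "\<dots> \<le> \<phi> c + g c * (y - c)"
    using subgradient[of q c] by simp
  finally show ?thesis by (simp add: tangent_extension_def c_def Let_def)
qed

lemma tangent_extension_subgradient:
  assumes "0 \<le> r"
  shows "tangent_extension \<phi> g r x + g (max (- r) (min r x)) * (y - x) \<le> tangent_extension \<phi> g r y"
  using tangent_le_extension[of "max (- r) (min r x)" r y] assms
  by (simp add: tangent_extension_def[of _ _ _ x] Let_def algebra_simps)

lemma tangent_extension_le: "tangent_extension \<phi> g r x \<le> \<phi> x"
  unfolding tangent_extension_def Let_def by (rule subgradient)

lemma tangent_extension_mono:
  assumes "0 \<le> r" "r \<le> s"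
  shows "tangent_extension \<phi> g r x \<le> tangent_extension \<phi> g s x"
  using tangent_le_extension[of "max (- r) (min r x)" s x] assms
  by (simp add: tangent_extension_def[of _ _ r] Let_def)

lemma tangent_extension_eq: "\<bar>x\<bar> \<le> r \<Longrightarrow> tangent_extension \<phi> g r x = \<phi> x"
proof -
  assume "\<bar>x\<bar> \<le> r"
  then have "max (- r) (min r x) = x" by auto
  then show ?thesis by (simp add: tangent_extension_def)
qed

lemma borel_measurable_convex: "\<phi> \<in> borel_measurable borel"
  using convex_on_continuous[OF open_UNIV convex] by (rule borel_measurable_continuous_onI)

lemma borel_measurable_tangent_extension [measurable]:
  "tangent_extension \<phi> g r \<in> borel_measurable borel"
proof -
  note [measurable] = borel_measurable_convex borel_measurable_mono[OF mono_g]
  show ?thesis unfolding tangent_extension_def Let_def by measurable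
qed

lemma integrable_tangent_extension:
  assumes "real_distribution M" "integrable M (\<lambda>y. y)" "0 \<le> r"
  shows "integrable M (tangent_extension \<phi> g r)"
proof -
  interpret real_distribution M by fact
  define B where "B = \<bar>g 0\<bar> + \<bar>g r\<bar> + \<bar>g (- r)\<bar>"
  show ?thesis
  proof (rule Bochner_Integration.integrable_bound)
    show "integrable M (\<lambda>y. \<bar>\<phi> 0\<bar> + B * \<bar>y\<bar>)" using assms(2) by simp
    show "AE y in M. norm (tangent_extension \<phi> g r y) \<le> norm (\<bar>\<phi> 0\<bar> + B * \<bar>y\<bar>)"
    proof (rule AE_I2)
      fix y
      define c where "c = max (- r) (min r y)"
      have slope: "\<bar>s * y\<bar> \<le> B * \<bar>y\<bar>" if "\<bar>s\<bar> \<le> B" for s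
        using that by (simp add: abs_mult mult_right_mono)
      have "g (- r) \<le> g c" "g c \<le> g r"
        using assms(3) by (auto simp: c_def intro!: monoD[OF mono_g])
      then have "\<bar>g c * y\<bar> \<le> B * \<bar>y\<bar>" "\<bar>g 0 * y\<bar> \<le> B * \<bar>y\<bar>"
        unfolding B_def[symmetric] by (intro slope; simp add: B_def)+
      moreover have "\<phi> 0 + g 0 * y \<le> tangent_extension \<phi> g r y"
        using tangent_le_extension[of 0 r y] assms(3) by simp
      moreover have "tangent_extension \<phi> g r y \<le> \<phi> 0 + g c * y"
        using tangent_extension_subgradient[OF assms(3), of y 0] tangent_extension_eq[of 0 r] assms(3)
        by (simp add: c_def)
      ultimately show "norm (tangent_extension \<phi> g r y) \<le> norm (\<bar>\<phi> 0\<bar> + B * \<bar>y\<bar>)"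
        by (auto simp: abs_le_iff)
    qed
  qed simp
qed

end

section \<open>From integrated quantiles to convex order\<close>

lemma integral_well_defined_integrable:
  assumes "integrable M f"
  shows "integral_well_defined M f"
  using assms unfolding integral_well_defined_def real_integrable_def by (auto simp: top.not_eq_extremum)

lemma extended_integral_integrable:
  assumes "integrable M f"
  shows "extended_integral M f = ereal (LINT y|M. f y)"
proof -
  obtain a b where ab: "0 \<le> a" "0 \<le> b"
    "(\<integral>\<^sup>+x. ennreal (f x) \<partial>M) = ennreal a" "(\<integral>\<^sup>+x. ennreal (- f x) \<partial>M) = ennreal b"
    using assms unfolding real_integrable_def by (metis ennreal_cases infinity_ennreal_def)
  show ?thesis
    unfolding extended_integral_def real_lebesgue_integral_def[OF assms] ab
    using ab(1,2) by (simp add: enn2ereal_ennreal)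
qed

text \<open>
  Subtracting an integrable minorant \<open>l\<close> leaves a nonnegative function, so that infinite integrals
  can be compared without a difference of infinities.
\<close>

lemma extended_integral_minorant:
  assumes \<phi>: "integral_well_defined M \<phi>" and l: "integrable M l" and le: "\<And>y. l y \<le> \<phi> y"
  shows "extended_integral M \<phi> = enn2ereal (\<integral>\<^sup>+y. ennreal (\<phi> y - l y) \<partial>M) + ereal (LINT y|M. l y)"
proof -
  have [measurable]: "\<phi> \<in> borel_measurable M" "l \<in> borel_measurable M"
    using \<phi> l by (auto simp: integral_well_defined_def)
  have abs_l: "(\<integral>\<^sup>+y. ennreal \<bar>l y\<bar> \<partial>M) < \<infinity>"
    using integrable_abs[OF l] by (simp add: integrable_iff_bounded)
  show ?thesis
  proof (cases "(\<integral>\<^sup>+y. ennreal (\<phi> y - l y) \<partial>M) < \<infinity>")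
    case True
    then have diff: "integrable M (\<lambda>y. \<phi> y - l y)"
      using le by (intro integrableI_nonneg) auto
    then have int: "integrable M \<phi>"
      using Bochner_Integration.integrable_add[OF diff l] by simp
    have "(\<integral>\<^sup>+y. ennreal (\<phi> y - l y) \<partial>M) = ennreal (LINT y|M. \<phi> y - l y)"
      using le by (intro nn_integral_eq_integral diff) auto
    moreover have "0 \<le> (LINT y|M. \<phi> y - l y)"
      using le by (intro Bochner_Integration.integral_nonneg) auto
    ultimately show ?thesis
      unfolding extended_integral_integrable[OF int] using int l by (simp add: enn2ereal_ennreal)
  next
    case False
    then have excess: "(\<integral>\<^sup>+y. ennreal (\<phi> y - l y) \<partial>M) = \<infinity>"
      by (metis infinity_ennreal_def less_top)
    have "(\<integral>\<^sup>+y. ennreal (\<phi> y - l y) \<partial>M) \<le> (\<integral>\<^sup>+y. ennreal (\<phi> y) + ennreal \<bar>l y\<bar> \<partial>M)"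
    proof (rule nn_integral_mono)
      fix y
      have "ennreal (\<phi> y - l y) \<le> ennreal (max 0 (\<phi> y) + \<bar>l y\<bar>)"
        by (rule ennreal_leI) auto
      also have "\<dots> = ennreal (\<phi> y) + ennreal \<bar>l y\<bar>"
        by (simp add: ennreal_plus max_def ennreal_neg)
      finally show "ennreal (\<phi> y - l y) \<le> ennreal (\<phi> y) + ennreal \<bar>l y\<bar>" .
    qed
    also have "\<dots> = (\<integral>\<^sup>+y. ennreal (\<phi> y) \<partial>M) + (\<integral>\<^sup>+y. ennreal \<bar>l y\<bar> \<partial>M)"
      by (intro nn_integral_add) auto
    finally have "(\<integral>\<^sup>+y. ennreal (\<phi> y) \<partial>M) + (\<integral>\<^sup>+y. ennreal \<bar>l y\<bar> \<partial>M) = \<infinity>"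
      using excess by (simp add: top_unique)
    then have pos: "(\<integral>\<^sup>+y. ennreal (\<phi> y) \<partial>M) = \<infinity>"
      using abs_l by (auto simp: ennreal_add_eq_top)
    have "(\<integral>\<^sup>+y. ennreal (- \<phi> y) \<partial>M) \<le> (\<integral>\<^sup>+y. ennreal \<bar>l y\<bar> \<partial>M)"
    proof (intro nn_integral_mono ennreal_leI)
      show "- \<phi> y \<le> \<bar>l y\<bar>" for y using le[of y] by linarith
    qed
    then have "(\<integral>\<^sup>+y. ennreal (- \<phi> y) \<partial>M) < \<infinity>"
      using abs_l by simp
    then obtain b where b: "0 \<le> b" "(\<integral>\<^sup>+y. ennreal (- \<phi> y) \<partial>M) = ennreal b"
      by (cases "\<integral>\<^sup>+y. ennreal (- \<phi> y) \<partial>M") auto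
    show ?thesis
      using b(1) unfolding extended_integral_def pos b(2) excess
      by (simp add: enn2ereal_ennreal)
  qed
qed

text \<open>
  The inequality \<open>T (Q' u) - T (Q u) \<ge> h u (Q' u - Q u)\<close>, with \<open>T\<close> the extension and \<open>h u\<close> its slope
  at \<open>Q u\<close>, is integrated over \<open>u\<close>. The slope is bounded and increasing in \<open>u\<close>.
\<close>

lemma (in convex_with_subgradient) integral_tangent_extension_le:
  assumes M: "finite_mean_distribution M" and N: "finite_mean_distribution N"
    and total: "integrated_quantile M 1 = integrated_quantile N 1"
    and le: "\<And>p. \<lbrakk>0 < p; p < 1\<rbrakk> \<Longrightarrow> integrated_quantile N p \<le> integrated_quantile M p"
    and r: "0 \<le> r"
  shows "(LINT y|M. tangent_extension \<phi> g r y) \<le> (LINT y|N. tangent_extension \<phi> g r y)"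
proof -
  interpret M: finite_mean_distribution M by (fact M)
  interpret N: finite_mean_distribution N by (fact N)
  let ?T = "tangent_extension \<phi> g r"
  define D where "D u = quantile N u - quantile M u" for u
  define h where "h u = g (max (- r) (min r (quantile M u)))" for u
  have D: "integrable unif D"
    unfolding D_def using M.integrable_quantile N.integrable_quantile by simp
  have partial: "(LINT u|unif. indicator {..<p} u * D u)
      = integrated_quantile N p - integrated_quantile M p" if "p \<le> 1" for p
    unfolding D_def right_diff_distrib M.integrated_quantile_unif[OF that] N.integrated_quantile_unif[OF that]
    by (intro Bochner_Integration.integral_diff integrable_unif_initial
        M.integrable_quantile N.integrable_quantile)
  have D_0: "(LINT u|unif. D u) = 0"
  proof -
    have "(LINT u|unif. D u) = (LINT u|unif. indicator {..<1} u * D u)"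
      by (intro Bochner_Integration.integral_cong) (auto simp: space_restrict_space)
    then show ?thesis using partial[of 1] total by simp
  qed
  have initial: "(LINT u|unif. indicator {..<p} u * D u) \<le> 0" if "0 < p" "p < 1" for p
    using partial[of p] le[OF that] that by simp
  have mono: "mono_on {0<..<1} h"
    unfolding h_def
    by (intro mono_onI monoD[OF mono_g] max.mono min.mono M.quantile_mono) auto
  have bounds: "g (- r) \<le> h u \<and> h u \<le> g r" for u
    unfolding h_def using r by (intro conjI monoD[OF mono_g]) auto
  note weight = integral_monotone_weight_nonneg[OF mono bounds D D_0 initial]
  have int_M: "integrable unif (\<lambda>u. ?T (quantile M u))"
    using integrable_tangent_extension[OF M.real_distribution_axioms M.integrable_ident r]
    by (intro M.integrable_quantile_iff[THEN iffD2]) auto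
  have int_N: "integrable unif (\<lambda>u. ?T (quantile N u))"
    using integrable_tangent_extension[OF N.real_distribution_axioms N.integrable_ident r]
    by (intro N.integrable_quantile_iff[THEN iffD2]) auto
  have "0 \<le> (LINT u|unif. h u * D u)"
    by (rule weight(2))
  also have "\<dots> \<le> (LINT u|unif. ?T (quantile N u) - ?T (quantile M u))"
  proof (intro integral_mono weight(1) Bochner_Integration.integrable_diff int_M int_N)
    show "h u * D u \<le> ?T (quantile N u) - ?T (quantile M u)" for u
      using tangent_extension_subgradient[OF r, of "quantile M u" "quantile N u"]
      by (simp add: h_def D_def)
  qed
  also have "\<dots> = (LINT y|N. ?T y) - (LINT y|M. ?T y)"
    using int_M int_N by (simp add: M.integral_quantile N.integral_quantile)
  finally show ?thesis by simp
qed

text \<open>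
  Monotone convergence applies because the extensions increase with \<open>r\<close>, equal \<open>\<phi>\<close> at a given
  point as soon as \<open>r\<close> exceeds its modulus, and lie above the supporting line at 0.
\<close>

lemma (in convex_with_subgradient) nn_integral_excess_eq_SUP:
  assumes "sets M = sets borel"
  shows "(\<integral>\<^sup>+y. ennreal (\<phi> y - (\<phi> 0 + g 0 * y)) \<partial>M)
    = (SUP n. \<integral>\<^sup>+y. ennreal (tangent_extension \<phi> g (real n) y - (\<phi> 0 + g 0 * y)) \<partial>M)"
proof -
  let ?T = "\<lambda>n y. ennreal (tangent_extension \<phi> g (real n) y - (\<phi> 0 + g 0 * y))"
  have [measurable_cong]: "sets M = sets borel" by fact
  have inc: "incseq (\<lambda>n. ?T n)"
    by (auto simp: incseq_def le_fun_def intro!: ennreal_leI tangent_extension_mono)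
  have "(SUP n. ?T n y) = ennreal (\<phi> y - (\<phi> 0 + g 0 * y))" for y
  proof (rule antisym)
    show "(SUP n. ?T n y) \<le> ennreal (\<phi> y - (\<phi> 0 + g 0 * y))"
      by (intro SUP_least ennreal_leI) (simp add: tangent_extension_le)
    obtain n :: nat where "\<bar>y\<bar> \<le> real n" using real_arch_simple by blast
    then show "ennreal (\<phi> y - (\<phi> 0 + g 0 * y)) \<le> (SUP n. ?T n y)"
      by (intro SUP_upper2[of n]) (auto simp: tangent_extension_eq)
  qed
  then have "(\<integral>\<^sup>+y. ennreal (\<phi> y - (\<phi> 0 + g 0 * y)) \<partial>M) = (\<integral>\<^sup>+y. (SUP n. ?T n y) \<partial>M)"
    by simp
  also have "\<dots> = (SUP n. \<integral>\<^sup>+y. ?T n y \<partial>M)"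
    by (rule nn_integral_monotone_convergence_SUP[OF inc]) measurable
  finally show ?thesis .
qed

lemma convex_order_of_integrated_quantile:
  assumes M: "finite_mean_distribution M" and N: "finite_mean_distribution N"
    and total: "integrated_quantile M 1 = integrated_quantile N 1"
    and le: "\<And>p. \<lbrakk>0 < p; p < 1\<rbrakk> \<Longrightarrow> integrated_quantile N p \<le> integrated_quantile M p"
  shows "M \<preceq>\<^sub>c N"
  unfolding convex_order_def
proof (intro allI impI, elim conjE)
  fix \<phi> :: "real \<Rightarrow> real"
  assume convex: "convex_on UNIV \<phi>" and wd: "integral_well_defined M \<phi>" "integral_well_defined N \<phi>"
  interpret M: finite_mean_distribution M by (fact M)
  interpret N: finite_mean_distribution N by (fact N)
  obtain g where g: "mono g" "\<And>x y. \<phi> x + g x * (y - x) \<le> \<phi> y"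
    using convex_on_UNIV_subgradient[OF convex] by blast
  interpret convex_with_subgradient \<phi> g
    using convex g by unfold_locales
  define l where "l y = \<phi> 0 + g 0 * y" for y
  have l: "integrable M l" "integrable N l"
    unfolding l_def using M.integrable_ident N.integrable_ident by simp_all
  have l_eq: "(LINT y|M. l y) = (LINT y|N. l y)"
    using total M.integrable_ident N.integrable_ident M.prob_space N.prob_space
    by (simp add: l_def M.integrated_quantile_1 N.integrated_quantile_1 mean_def)
  have l_le: "l y \<le> \<phi> y" for y
    using subgradient[of 0 y] by (simp add: l_def)
  let ?T = "\<lambda>n. tangent_extension \<phi> g (real n)"
  have step: "(\<integral>\<^sup>+y. ennreal (?T n y - l y) \<partial>M) \<le> (\<integral>\<^sup>+y. ennreal (?T n y - l y) \<partial>N)" for n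
  proof -
    have T: "integrable M (?T n)" "integrable N (?T n)"
      by (rule integrable_tangent_extension[OF M.real_distribution_axioms M.integrable_ident of_nat_0_le_iff]
          integrable_tangent_extension[OF N.real_distribution_axioms N.integrable_ident of_nat_0_le_iff])+
    have nonneg: "0 \<le> ?T n y - l y" for y
      using tangent_le_extension[of 0 "real n" y] by (simp add: l_def)
    have "(\<integral>\<^sup>+y. ennreal (?T n y - l y) \<partial>M) = ennreal (LINT y|M. ?T n y - l y)"
      using T l nonneg by (intro nn_integral_eq_integral) auto
    also have "\<dots> \<le> ennreal (LINT y|N. ?T n y - l y)"
      using T l l_eq integral_tangent_extension_le[OF M N total le, of "real n"]
      by (intro ennreal_leI) simp
    also have "\<dots> = (\<integral>\<^sup>+y. ennreal (?T n y - l y) \<partial>N)"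
      using T l nonneg by (intro nn_integral_eq_integral[symmetric]) auto
    finally show ?thesis .
  qed
  have "(\<integral>\<^sup>+y. ennreal (\<phi> y - l y) \<partial>M) \<le> (\<integral>\<^sup>+y. ennreal (\<phi> y - l y) \<partial>N)"
    unfolding l_def nn_integral_excess_eq_SUP[OF M.events_eq_borel]
      nn_integral_excess_eq_SUP[OF N.events_eq_borel]
    using step by (intro SUP_mono) (auto simp: l_def)
  then show "extended_integral M \<phi> \<le> extended_integral N \<phi>"
    unfolding extended_integral_minorant[OF wd(1) l(1) l_le]
      extended_integral_minorant[OF wd(2) l(2) l_le] l_eq
    by (intro add_right_mono) (simp add: less_eq_ennreal.rep_eq)
qed

lemma convex_order_integral_le:
  assumes "M \<preceq>\<^sub>c N" "convex_on UNIV \<phi>" "integrable M \<phi>" "integrable N \<phi>"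
  shows "(LINT y|M. \<phi> y) \<le> (LINT y|N. \<phi> y)"
  using assms unfolding convex_order_def
  by (metis ereal_less_eq(3) extended_integral_integrable integral_well_defined_integrable)

lemma convex_on_call: "convex_on UNIV (\<lambda>y::real. max (y - x) 0)"
proof (rule convex_onI)
  fix t a b :: real assume t: "0 < t" "t < 1"
  have "(1 - t) * (a - x) + t * (b - x) \<le> (1 - t) * max (a - x) 0 + t * max (b - x) 0"
    using t by (intro add_mono mult_left_mono) auto
  moreover have "0 \<le> (1 - t) * max (a - x) 0 + t * max (b - x) 0"
    using t by (intro add_nonneg_nonneg mult_nonneg_nonneg) auto
  moreover have "(1 - t) *\<^sub>R a + t *\<^sub>R b - x = (1 - t) * (a - x) + t * (b - x)"
    by (simp add: algebra_simps)
  ultimately show "max ((1 - t) *\<^sub>R a + t *\<^sub>R b - x) 0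
      \<le> (1 - t) * max (a - x) 0 + t * max (b - x) 0"
    by simp
qed auto

section \<open>Convex order and irreducibility\<close>

locale finite_mean_distribution_pair =
  M: finite_mean_distribution M + N: finite_mean_distribution N for M N
begin

lemma convex_order_mean:
  assumes "M \<preceq>\<^sub>c N"
  shows "mean M = mean N"
proof (rule antisym)
  show "mean M \<le> mean N"
    unfolding mean_def
    by (rule convex_order_integral_le[OF assms])
       (auto simp: M.integrable_ident N.integrable_ident intro!: convex_onI)
  have "(LINT y|M. - y) \<le> (LINT y|N. - y)"
    by (rule convex_order_integral_le[OF assms])
       (auto simp: M.integrable_ident N.integrable_ident intro!: convex_onI)
  then show "mean N \<le> mean M" by (simp add: mean_def)
qed

lemma call_less_iff_put_less:
  assumes "mean M = mean N"
  shows "call_function M x < call_function N x \<longleftrightarrow> put_function M x < put_function N x"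
  using assms by (simp add: M.put_call_parity N.put_call_parity)

lemma convex_order_put_le:
  assumes "M \<preceq>\<^sub>c N"
  shows "put_function M x \<le> put_function N x"
proof -
  have "call_function M x \<le> call_function N x"
    unfolding call_function_def
    by (rule convex_order_integral_le[OF assms convex_on_call M.integrable_call N.integrable_call])
  then show ?thesis
    using convex_order_mean[OF assms] by (simp add: M.put_call_parity N.put_call_parity)
qed

lemma convex_order_iff:
  "M \<preceq>\<^sub>c N \<longleftrightarrow> integrated_quantile M 1 = integrated_quantile N 1 \<and>
     (\<forall>p\<in>{0<..<1}. integrated_quantile M p \<ge> integrated_quantile N p)"
proof (intro iffI conjI ballI)
  assume order: "M \<preceq>\<^sub>c N"
  show "integrated_quantile M 1 = integrated_quantile N 1"
    using convex_order_mean[OF order] by (simp add: M.integrated_quantile_1 N.integrated_quantile_1)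
  fix p :: real assume p: "p \<in> {0<..<1}"
  let ?x = "quantile N p"
  have "p * ?x - integrated_quantile M p \<le> put_function M ?x"
    using p by (intro M.put_ge) auto
  also have "\<dots> \<le> put_function N ?x" by (rule convex_order_put_le[OF order])
  also have "\<dots> = p * ?x - integrated_quantile N p"
    using p by (intro N.put_quantile) auto
  finally show "integrated_quantile M p \<ge> integrated_quantile N p" by simp
next
  assume "integrated_quantile M 1 = integrated_quantile N 1 \<and>
     (\<forall>p\<in>{0<..<1}. integrated_quantile M p \<ge> integrated_quantile N p)"
  then show "M \<preceq>\<^sub>c N"
    by (intro convex_order_of_integrated_quantile
        M.finite_mean_distribution_axioms N.finite_mean_distribution_axioms) auto
qed

text \<open>
  If \<open>U p = U' p\<close>, then \<open>x = Q' p\<close> is extremal for both laws. Extremality for \<open>M\<close> makes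
  \<open>x\<close> a \<open>p\<close>-quantile of \<open>M\<close>, although \<open>x\<close> lies outside the interval \<open>I\<close> that carries \<open>M\<close>.
\<close>

lemma integrated_quantile_strict_of_irreducible:
  assumes irr: "irreducible_pair M N" and p: "0 < p" "p < 1"
  shows "integrated_quantile N p < integrated_quantile M p"
proof (rule ccontr)
  assume not_less: "\<not> integrated_quantile N p < integrated_quantile M p"
  define I where "I = {x. call_function M x < call_function N x}"
  define x where "x = quantile N p"
  have order: "M \<preceq>\<^sub>c N" and interval: "is_interval I" and full: "measure M I = 1"
    using irr by (auto simp: irreducible_pair_def I_def Let_def)
  have "integrated_quantile M p = integrated_quantile N p"
    using not_less order p unfolding convex_order_iff by force
  then have "put_function N x = p * x - integrated_quantile M p"
    unfolding x_def using N.put_quantile[OF p] by simp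
  then have eq: "put_function M x = p * x - integrated_quantile M p"
    using convex_order_put_le[OF order, of x] M.put_ge[of p x] p by simp
  then have "put_function M x = put_function N x"
    using \<open>put_function N x = p * x - integrated_quantile M p\<close> by simp
  then have "x \<notin> I"
    using call_less_iff_put_less[OF convex_order_mean[OF order]] by (simp add: I_def)
  \<comment> \<open>A set outside the sigma-algebra would have measure 0.\<close>
  have I_events: "I \<in> sets M"
    using full measure_notin_sets[of I M] by force
  have AE_I: "AE u in unif. quantile M u \<in> I"
    using M.prob_eq_1[OF I_events] full I_events by (subst M.AE_quantile[symmetric]) auto
  have AE_sides: "AE u in unif. (u < p \<longrightarrow> quantile M u \<le> x) \<and> (p \<le> u \<longrightarrow> x \<le> quantile M u)"
    using eq M.put_eq_iff[of p x] p by simp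
  have "(\<forall>y\<in>I. x < y) \<or> (\<forall>y\<in>I. y < x)"
    using interval \<open>x \<notin> I\<close> unfolding is_interval_1 by (metis linorder_less_linear less_imp_le)
  then show False
  proof
    assume above: "\<forall>y\<in>I. x < y"
    have "AE u in unif. u \<notin> {0<..<p}"
      using AE_I AE_sides by eventually_elim (use above in force)
    then show False using not_AE_unif_interval[of 0 p] p by simp
  next
    assume below: "\<forall>y\<in>I. y < x"
    have "AE u in unif. u \<notin> {p<..<1}"
      using AE_I AE_sides by eventually_elim (use below in force)
    then show False using not_AE_unif_interval[of p 1] p by simp
  qed
qed

text \<open>
  That \<open>M\<close> gives full mass to \<open>I\<close> is clear from \<open>Q u \<in> I\<close> for all \<open>u\<close>. For the interval property, it
  suffices to describe \<open>I\<close> by the two monotone functions \<open>P'\<close> and \<open>C'\<close> of \<open>N\<close>: where \<open>F x\<close> is strictly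
  between 0 and 1, the point \<open>x\<close> is in \<open>I\<close> by strict conjugacy, and elsewhere \<open>P x\<close> or \<open>C x\<close> vanishes.
\<close>

lemma irreducible_of_integrated_quantile_strict:
  assumes total: "integrated_quantile M 1 = integrated_quantile N 1"
    and less: "\<And>p. \<lbrakk>0 < p; p < 1\<rbrakk> \<Longrightarrow> integrated_quantile N p < integrated_quantile M p"
  shows "irreducible_pair M N"
proof -
  have order: "M \<preceq>\<^sub>c N"
    unfolding convex_order_iff using total less by (auto intro: less_imp_le)
  note mean = convex_order_mean[OF order]
  define I where "I = {x. call_function M x < call_function N x}"
  \<comment> \<open>Here \<open>P x = p x - U p < p x - U' p \<le> P' x\<close>.\<close>
  have touch: "x \<in> I" if "put_function M x = p * x - integrated_quantile M p" "0 < p" "p < 1" for x p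
    using that less[of p] N.put_ge[of p x] call_less_iff_put_less[OF mean, of x]
    by (simp add: I_def)
  have I_eq: "I = {x. 0 < put_function N x} \<inter> {x. 0 < call_function N x}"
  proof (intro set_eqI iffI IntI CollectI; (elim IntE CollectE)?)
    fix x assume "x \<in> I"
    then show "0 < put_function N x" "0 < call_function N x"
      using M.put_nonneg[of x] M.call_nonneg[of x] call_less_iff_put_less[OF mean, of x]
      by (auto simp: I_def)
  next
    fix x assume pos: "0 < put_function N x" "0 < call_function N x"
    consider "cdf M x = 0" | "cdf M x = 1" | "0 < cdf M x" "cdf M x < 1"
      using M.cdf_nonneg[of x] M.cdf_bounded_prob[of x] by force
    then show "x \<in> I"
    proof cases
      case 1
      then have "put_function M x = 0"
        using M.put_cdf[of x] by (simp add: M.integrated_quantile_0)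
      then show ?thesis
        using pos call_less_iff_put_less[OF mean, of x] by (simp add: I_def)
    next
      case 2
      then have "call_function M x = 0"
        using M.put_cdf[of x] M.put_call_parity[of x] by (simp add: M.integrated_quantile_1)
      then show ?thesis using pos by (simp add: I_def)
    next
      case 3
      then show ?thesis by (intro touch[OF M.put_cdf])
    qed
  qed
  have interval: "is_interval I"
    unfolding is_interval_1 I_eq using N.put_mono N.call_antimono by (auto intro: less_le_trans)
  have I_events: "I \<in> sets M"
  proof -
    have [measurable]: "put_function N \<in> borel_measurable borel"
      using N.put_mono by (intro borel_measurable_mono monoI)
    show ?thesis unfolding I_eq N.put_call_parity by simp
  qed
  have "AE u in unif. quantile M u \<in> I"
    by (intro AE_I2 touch[OF M.put_quantile]) (auto simp: space_restrict_space)
  then have "AE y in M. y \<in> I"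
    using I_events by (subst M.AE_quantile) auto
  then have "measure M I = 1"
    using I_events by (simp add: M.prob_eq_1)
  then show ?thesis
    using order interval by (simp add: irreducible_pair_def I_def Let_def)
qed

end

theorem proposition1p8:
  fixes \<eta> \<eta>' :: "real measure"
  assumes "real_distribution \<eta>" and "real_distribution \<eta>'"
    and "integrable \<eta> (\<lambda>y. y)" and "integrable \<eta>' (\<lambda>y. y)"
  shows "(integrated_quantile_well_defined \<eta> \<and>
          convex_on {0..1} (integrated_quantile \<eta>) \<and>
          integrated_quantile \<eta> 0 = 0 \<and>
          integrated_quantile \<eta> 1 = mean \<eta>) \<and>
         (\<eta> \<preceq>\<^sub>c \<eta>' \<longleftrightarrow>
            integrated_quantile \<eta> 1 = integrated_quantile \<eta>' 1 \<and>
            (\<forall>p\<in>{0<..<1}. integrated_quantile \<eta> p \<ge> integrated_quantile \<eta>' p)) \<and>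
         (irreducible_pair \<eta> \<eta>' \<longleftrightarrow>
            integrated_quantile \<eta> 1 = integrated_quantile \<eta>' 1 \<and>
            (\<forall>p\<in>{0<..<1}. integrated_quantile \<eta> p > integrated_quantile \<eta>' p))"
proof -
  interpret finite_mean_distribution_pair \<eta> \<eta>'
    using assms
    by (intro finite_mean_distribution_pair.intro finite_mean_distribution.intro
        cdf_distribution.intro finite_mean_distribution_axioms.intro)
  have "irreducible_pair \<eta> \<eta>' \<longleftrightarrow>
      integrated_quantile \<eta> 1 = integrated_quantile \<eta>' 1 \<and>
      (\<forall>p\<in>{0<..<1}. integrated_quantile \<eta> p > integrated_quantile \<eta>' p)"
  proof (intro iffI conjI ballI)
    assume irr: "irreducible_pair \<eta> \<eta>'"
    then show "integrated_quantile \<eta> 1 = integrated_quantile \<eta>' 1"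
      using convex_order_iff by (simp add: irreducible_pair_def)
    show "integrated_quantile \<eta> p > integrated_quantile \<eta>' p" if "p \<in> {0<..<1}" for p
      using integrated_quantile_strict_of_irreducible[OF irr] that by simp
  qed (auto intro: irreducible_of_integrated_quantile_strict)
  then show ?thesis
    using M.integrated_quantile_well_defined M.convex_integrated_quantile
      M.integrated_quantile_0 M.integrated_quantile_1 convex_order_iff
    by blast
qed

end
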